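(* Let $G$ be a finite chordal graph that is not a clique. Then $G$ contains two non-adjacent special simplicial vertices.
   Context: Graphs are finite, without loops or parallel edges. A graph is chordal if it has no induced cycle of length at least four. For vertices $u,v$ of $G$, a $\{u,v\}$-separator is a set $S$ of vertices such that $u$ and $v$ lie in different connected components of $G\setminus S$, and $S$ is inclusion-minimal with this property. A set is a separator if it is a $\{u,v\}$-separator for some vertices $u,v$ of $G$; $\mathcal S(G)$ denotes the set of all separators of $G$. $N(v)$ denotes the set of vertices adjacent to $v$. A vertex $v$ is simplicial if $N(v)$ is a clique. For a simplicial vertex $v$, let $Q_v=N(v)\cup\{v\}$ and $S_v=Q_v\cap N(V(G)\setminus Q_v)$, i.e. the set of vertices of $Q_v$ that have a neighbor outside $Q_v$. A simplicial vertex $v$ is special if $S_v\in\mathcal S(G)$ and $S_v$ is an inclusion-maximal element of $\mathcal S(G)$. *)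

theory Defs
  imports "Graph_Theory.Digraph_Component"
begin

text \<open>
  A finite simple graph is given by the locale \<^locale>\<open>graph\<close> of the library: a finite
  symmetric digraph without loops and parallel arcs, so an edge is a pair of opposite arcs. For
  such a digraph the strongly connected components are the connected components.
\<close>

definition neighbors :: "('a, 'b) pre_digraph \<Rightarrow> 'a \<Rightarrow> 'a set" where
  "neighbors G v = {w. v \<rightarrow>\<^bsub>G\<^esub> w}"

definition clique :: "('a, 'b) pre_digraph \<Rightarrow> 'a set \<Rightarrow> bool" where
  "clique G X \<longleftrightarrow> X \<subseteq> verts G \<and> (\<forall>u \<in> X. \<forall>v \<in> X. u \<noteq> v \<longrightarrow> u \<rightarrow>\<^bsub>G\<^esub> v)"

text \<open>
  A cycle is a closed arc walk \<open>p\<close>, whose vertices are the tails of its arcs. It is induced if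
  every arc of \<open>G\<close> between vertices of the cycle is an arc of \<open>p\<close> or the opposite of one.
\<close>

definition induced_cycle :: "('a, 'b) pre_digraph \<Rightarrow> 'b awalk \<Rightarrow> bool" where
  "induced_cycle G p \<longleftrightarrow> pre_digraph.cycle G p \<and>
     (\<forall>a \<in> arcs (G \<restriction> (tail G ` set p)). \<exists>e \<in> set p.
        arc_to_ends G a = (tail G e, head G e) \<or> arc_to_ends G a = (head G e, tail G e))"

definition chordal :: "('a, 'b) pre_digraph \<Rightarrow> bool" where
  "chordal G \<longleftrightarrow> \<not> (\<exists>p. induced_cycle G p \<and> 4 \<le> length p)"

definition separates :: "('a, 'b) pre_digraph \<Rightarrow> 'a \<Rightarrow> 'a \<Rightarrow> 'a set \<Rightarrow> bool" where
  "separates G u v S \<longleftrightarrow> S \<subseteq> verts G \<and>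
     (\<exists>C \<in> pre_digraph.sccs_verts (G \<restriction> (verts G - S)).
      \<exists>D \<in> pre_digraph.sccs_verts (G \<restriction> (verts G - S)). u \<in> C \<and> v \<in> D \<and> C \<noteq> D)"

definition uv_separator :: "('a, 'b) pre_digraph \<Rightarrow> 'a \<Rightarrow> 'a \<Rightarrow> 'a set \<Rightarrow> bool" where
  "uv_separator G u v S \<longleftrightarrow> separates G u v S \<and> (\<forall>T. T \<subset> S \<longrightarrow> \<not> separates G u v T)"

text \<open>If \<open>G\<close> is disconnected, the empty set is a separator.\<close>

definition separators :: "('a, 'b) pre_digraph \<Rightarrow> 'a set set" where
  "separators G = {S. \<exists>u \<in> verts G. \<exists>v \<in> verts G. uv_separator G u v S}"

definition simplicial :: "('a, 'b) pre_digraph \<Rightarrow> 'a \<Rightarrow> bool" where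
  "simplicial G v \<longleftrightarrow> v \<in> verts G \<and> clique G (neighbors G v)"

definition closed_neighbors :: "('a, 'b) pre_digraph \<Rightarrow> 'a \<Rightarrow> 'a set" where
  "closed_neighbors G v = neighbors G v \<union> {v}"

definition boundary :: "('a, 'b) pre_digraph \<Rightarrow> 'a \<Rightarrow> 'a set" where
  "boundary G v = closed_neighbors G v \<inter>
     (\<Union>w \<in> verts G - closed_neighbors G v. neighbors G w)"

definition special :: "('a, 'b) pre_digraph \<Rightarrow> 'a \<Rightarrow> bool" where
  "special G v \<longleftrightarrow> simplicial G v \<and> boundary G v \<in> separators G \<and>
     (\<forall>S \<in> separators G. \<not> boundary G v \<subset> S)"

end

theory Submission
  imports Defs
begin

text \<open>
  Induction on the number of vertices. Let \<open>S\<close> be an inclusion-maximal separator, which is a clique by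
  Dirac's theorem. Let \<open>C\<close> be a component of \<open>G - S\<close> to which every vertex of \<open>S\<close> is adjacent; there are
  at least two of these, so it is enough to find a special vertex in \<open>C\<close>. Put \<open>H = G[C \<union> S]\<close>. If \<open>H\<close> is a
  clique, every vertex of \<open>C\<close> has boundary \<open>S\<close> and is special. Otherwise \<open>H\<close> has two non-adjacent special
  vertices; at least one of them lies in the component \<open>C\<close>, and it can be chosen so that its boundary is
  the same in \<open>G\<close> as in \<open>H\<close>. No separator of \<open>H\<close> lies inside \<open>S\<close>, since \<open>C\<close> is connected and adjacent to
  all of \<open>S\<close>. So a separator of \<open>G\<close> that properly contained the boundary would be a clique meeting \<open>C\<close>;
  it would then lie in \<open>C \<union> S\<close> and separate \<open>H\<close> as well, against maximality in \<open>H\<close>.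
\<close>

text \<open>Chords are excluded in terms of the arcs of the walk, as in
  \<open>induced_cycle\<close>, so that two such paths glued at their ends meet that condition
  directly.\<close>

definition (in pre_digraph) chordless_path :: "'a \<Rightarrow> 'b awalk \<Rightarrow> 'a \<Rightarrow> bool" where
  "chordless_path u p v \<longleftrightarrow> apath u p v \<and>
     (\<forall>x \<in> set (awalk_verts u p). \<forall>y \<in> set (awalk_verts u p). x \<rightarrow>\<^bsub>G\<^esub> y \<longrightarrow>
       (\<exists>e \<in> set p. (x, y) = (tail G e, head G e) \<or> (x, y) = (head G e, tail G e)))"

section \<open>Induced subgraphs\<close>

lemma graph_induce_subgraph:
  assumes "graph G" "W \<subseteq> verts G"
  shows "graph (G \<restriction> W)"
proof -
  interpret graph G by fact
  interpret H: wf_digraph "G \<restriction> W" by auto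
  have "finite W" using assms(2) finite_verts finite_subset by blast
  then have "digraph (G \<restriction> W)"
    by unfold_locales (auto dest: no_loops no_multi_arcs)
  moreover have "symmetric (G \<restriction> W)"
    using sym_arcs assms(2) by (auto intro: induced_graph_imp_symmetric)
  ultimately show ?thesis by (auto intro: digraph.graphI)
qed

lemma cliqueD:
  assumes "clique G X" "u \<in> X" "v \<in> X" "u \<noteq> v"
  shows "u \<rightarrow>\<^bsub>G\<^esub> v"
  using assms by (simp add: clique_def)

lemma dominates_induce_subgraph_iff:
  "u \<rightarrow>\<^bsub>G \<restriction> W\<^esub> v \<longleftrightarrow> u \<in> W \<and> v \<in> W \<and> u \<rightarrow>\<^bsub>G\<^esub> v"
  by (auto simp: arcs_ends_conv)

lemma induce_subgraph_induce_subgraph: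
  "(G \<restriction> W) \<restriction> X = G \<restriction> X" if "X \<subseteq> W"
  using that by (auto simp: induce_subgraph_def)

text \<open>An induced cycle of the subgraph is the same arc list in \<open>G\<close>: tails and
  heads agree, and since its vertices lie in \<open>W\<close>, restricting to them yields the same
  graph from either side.\<close>

lemma chordal_induce_subgraph:
  assumes "chordal G" "W \<subseteq> verts G"
  shows "chordal (G \<restriction> W)"
proof -
  have "induced_cycle G p" if p: "induced_cycle (G \<restriction> W) p" for p
  proof -
    have tails: "tail G ` set p \<subseteq> W"
      using p by (auto simp: induced_cycle_def pre_digraph.cycle_def pre_digraph.awalk_def)
    have verts: "pre_digraph.awalk_verts (G \<restriction> W) u q = pre_digraph.awalk_verts G u q" for u q
      by (induct q arbitrary: u) (auto simp: pre_digraph.awalk_verts.simps)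
    have "pre_digraph.cas (G \<restriction> W) u q v = pre_digraph.cas G u q v" for u q v
      by (induct q arbitrary: u) (auto simp: pre_digraph.cas.simps)
    then have "pre_digraph.cycle G p"
      using p assms(2) by (auto simp: induced_cycle_def pre_digraph.cycle_def pre_digraph.awalk_def verts)
    moreover have "\<forall>a \<in> arcs (G \<restriction> (tail G ` set p)). \<exists>e \<in> set p.
        arc_to_ends G a = (tail G e, head G e) \<or> arc_to_ends G a = (head G e, tail G e)"
      using p unfolding induced_cycle_def induce_subgraph_tail induce_subgraph_head
        induce_subgraph_ends induce_subgraph_induce_subgraph[OF tails] by (rule conjunct2)
    ultimately show ?thesis unfolding induced_cycle_def by (rule conjI)
  qed
  then show ?thesis using assms(1) by (auto simp: chordal_def)
qed

section \<open>Reachability in induced subgraphs\<close>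

context graph
begin

lemma dominates_sym: "u \<rightarrow>\<^bsub>G\<^esub> v \<Longrightarrow> v \<rightarrow>\<^bsub>G\<^esub> u"
  using sym_arcs by (rule arcs_ends_symmetric)

lemma dominates_irrefl: "\<not> u \<rightarrow>\<^bsub>G\<^esub> u"
  using adj_not_same by blast

lemma reachable_induce_sym:
  assumes "u \<rightarrow>\<^sup>*\<^bsub>G \<restriction> W\<^esub> v"
  shows "v \<rightarrow>\<^sup>*\<^bsub>G \<restriction> W\<^esub> u"
  using assms
  by (rule symmetric_reachable[rotated])
    (use dominates_sym in \<open>auto simp: symmetric_def sym_def dominates_induce_subgraph_iff\<close>)

lemma reachable_induce_in:
  assumes "u \<rightarrow>\<^sup>*\<^bsub>G \<restriction> W\<^esub> v"
  shows "u \<in> W" "v \<in> W"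
  using assms by (auto elim: reachable_in_vertsE)

lemma reachable_induce_trans:
  assumes "u \<rightarrow>\<^sup>*\<^bsub>G \<restriction> W\<^esub> v" "v \<rightarrow>\<^sup>*\<^bsub>G \<restriction> W\<^esub> w"
  shows "u \<rightarrow>\<^sup>*\<^bsub>G \<restriction> W\<^esub> w"
  using assms by (rule wf_digraph.reachable_trans[OF wellformed_induce_subgraph])

lemma reachable_induce_step:
  assumes "u \<rightarrow>\<^sup>*\<^bsub>G \<restriction> W\<^esub> v" "v \<rightarrow>\<^bsub>G\<^esub> w" "w \<in> W"
  shows "u \<rightarrow>\<^sup>*\<^bsub>G \<restriction> W\<^esub> w"
  using assms reachable_induce_in
  by (auto intro: wf_digraph.reachable_adj_trans[OF wellformed_induce_subgraph]
      simp: dominates_induce_subgraph_iff)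

lemma reachable_induce_refl: "u \<in> W \<Longrightarrow> u \<rightarrow>\<^sup>*\<^bsub>G \<restriction> W\<^esub> u"
  by (simp add: reachable_def)

lemma reachable_induce_induct [consumes 1, case_names base step]:
  assumes "u \<rightarrow>\<^sup>*\<^bsub>G \<restriction> W\<^esub> v"
    and "P u"
    and "\<And>x y. \<lbrakk>u \<rightarrow>\<^sup>*\<^bsub>G \<restriction> W\<^esub> x; x \<rightarrow>\<^bsub>G\<^esub> y; x \<in> W; y \<in> W; P x\<rbrakk> \<Longrightarrow> P y"
  shows "P v"
proof -
  interpret H: wf_digraph "G \<restriction> W" ..
  from assms(1) show ?thesis
    by (induct rule: H.reachable_induct)
      (use assms in \<open>auto simp: dominates_induce_subgraph_iff\<close>)
qed

section \<open>Chordless paths\<close>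

text \<open>Attaching \<open>x\<close> at the front could create chords. The recursion therefore
  drops the first vertex as long as the rest still contains \<open>x\<close> or a neighbor of
  \<open>x\<close>; what remains has no chord at \<open>x\<close>.\<close>

lemma chordless_path_Cons:
  assumes "chordless_path u p v" "x \<in> verts G"
    and "x \<in> set (awalk_verts u p) \<or> (\<exists>y \<in> set (awalk_verts u p). x \<rightarrow>\<^bsub>G\<^esub> y)"
  shows "\<exists>q. chordless_path x q v \<and> set (awalk_verts x q) \<subseteq> insert x (set (awalk_verts u p))"
  using assms(1,3)
proof (induct p arbitrary: u)
  case Nil
  then have [simp]: "v = u" "u \<in> verts G" by (auto simp: chordless_path_def apath_simps)
  show ?case
  proof (cases "x = u")
    case True
    then show ?thesis using Nil by auto
  next
    case False
    then obtain e where e: "e \<in> arcs G" "tail G e = x" "head G e = u" using Nil by auto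
    then have "chordless_path x [e] v"
      using False dominates_irrefl by (auto simp: chordless_path_def apath_simps)
    then show ?thesis using e by force
  qed
next
  case (Cons e p)
  have e: "tail G e = u" "e \<in> arcs G" and ap: "apath (head G e) p v"
    and u: "u \<notin> set (awalk_verts (head G e) p)"
    using Cons.prems(1) by (auto simp: chordless_path_def apath_Cons_iff)
  have "chordless_path (head G e) p v"
    unfolding chordless_path_def
  proof (intro conjI ballI impI ap)
    fix a b
    assume ab: "a \<in> set (awalk_verts (head G e) p)" "b \<in> set (awalk_verts (head G e) p)" "a \<rightarrow>\<^bsub>G\<^esub> b"
    then have "a \<in> set (awalk_verts u (e # p))" "b \<in> set (awalk_verts u (e # p))"
      by simp_all
    then obtain f where f: "f \<in> set (e # p)"
      "(a, b) = (tail G f, head G f) \<or> (a, b) = (head G f, tail G f)"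
      using Cons.prems(1) ab(3) unfolding chordless_path_def by meson
    \<comment> \<open>The arc \<open>e\<close> ends in \<open>u\<close>, and \<open>u\<close> does
      not lie on the rest of the path.\<close>
    moreover have "f \<noteq> e"
      using f(2) ab u e(1) by auto
    ultimately show "\<exists>f \<in> set p. (a, b) = (tail G f, head G f) \<or> (a, b) = (head G f, tail G f)"
      by auto
  qed
  note IH = Cons.hyps[OF this]
  consider "x \<in> set (awalk_verts (head G e) p) \<or> (\<exists>y \<in> set (awalk_verts (head G e) p). x \<rightarrow>\<^bsub>G\<^esub> y)"
    | "x = u"
    | "x \<notin> set (awalk_verts (head G e) p)" "x \<noteq> u" "x \<rightarrow>\<^bsub>G\<^esub> u"
      "\<And>y. y \<in> set (awalk_verts (head G e) p) \<Longrightarrow> \<not> x \<rightarrow>\<^bsub>G\<^esub> y"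
    using Cons.prems(2) e by auto
  then show ?case
  proof cases
    case 1
    then show ?thesis using IH by auto
  next
    case 2
    then show ?thesis using Cons.prems by auto
  next
    case 3
    then obtain f where f: "f \<in> arcs G" "tail G f = x" "head G f = u" by auto
    have "chordless_path x (f # e # p) v"
      unfolding chordless_path_def
    proof (intro conjI ballI impI)
      show "apath x (f # e # p) v"
        using f 3 e ap u by (auto simp: apath_Cons_iff)
      fix a b
      assume ab: "a \<in> set (awalk_verts x (f # e # p))" "b \<in> set (awalk_verts x (f # e # p))" "a \<rightarrow>\<^bsub>G\<^esub> b"
      then consider "a \<in> set (awalk_verts u (e # p))" "b \<in> set (awalk_verts u (e # p))"
        | "a = x" "b = u" | "a = u" "b = x"
        using f e 3 dominates_irrefl dominates_sym by auto
      then show "\<exists>g \<in> set (f # e # p). (a, b) = (tail G g, head G g) \<or> (a, b) = (head G g, tail G g)"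
      proof cases
        case 1
        then show ?thesis using ab(3) Cons.prems(1) unfolding chordless_path_def
          by (meson list.set_intros(2))
      qed (use f in auto)
    qed
    then show ?thesis using f e by (intro exI[of _ "f # e # p"]) auto
  qed
qed

lemma reachable_induce_chordless_path:
  assumes "u \<rightarrow>\<^sup>*\<^bsub>G \<restriction> W\<^esub> v" "W \<subseteq> verts G"
  shows "\<exists>p. chordless_path u p v \<and> set (awalk_verts u p) \<subseteq> W"
  \<comment> \<open>Paths grow at their front, so the induction follows the walk backwards, from
    \<open>v\<close> to \<open>u\<close>.\<close>
  using reachable_induce_sym[OF assms(1)]
proof (induct rule: reachable_induce_induct)
  case base
  have "v \<in> W" using assms(1) by (rule reachable_induce_in)
  then show ?case using assms(2) dominates_irrefl
    by (intro exI[of _ "[]"]) (auto simp: chordless_path_def apath_simps)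
next
  case (step x y)
  then obtain p where p: "chordless_path x p v" "set (awalk_verts x p) \<subseteq> W" by auto
  have "x \<in> set (awalk_verts x p)"
    using p by (auto simp: chordless_path_def apath_def hd_in_awalk_verts)
  then show ?case
    using chordless_path_Cons[OF p(1), of y] step assms(2) p(2) dominates_sym by blast
qed


section \<open>Separators\<close>

text \<open>In a symmetric digraph the strongly connected components are the classes of
  reachability, so components can be traded for unreachability from here on.\<close>

lemma separates_iff:
  "separates G u v S \<longleftrightarrow> S \<subseteq> verts G \<and> u \<in> verts G - S \<and> v \<in> verts G - S \<and>
    \<not> u \<rightarrow>\<^sup>*\<^bsub>G \<restriction> (verts G - S)\<^esub> v"
proof -
  interpret H: wf_digraph "G \<restriction> (verts G - S)" ..
  have comp: "H.scc_of x \<in> H.sccs_verts" "x \<in> H.scc_of x" if "x \<in> verts G - S" for x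
    using that H.scc_of_in_sccs_verts[of x] H.in_scc_of_self[of x] by auto
  show ?thesis (is "?L \<longleftrightarrow> ?R")
  proof
    assume ?L
    then obtain C D where CD: "S \<subseteq> verts G" "C \<in> H.sccs_verts" "D \<in> H.sccs_verts"
      "u \<in> C" "v \<in> D" "C \<noteq> D"
      by (auto simp: separates_def)
    then have "u \<in> verts G - S" "v \<in> verts G - S"
      using H.sccs_verts_subsets by auto
    moreover have "\<not> u \<rightarrow>\<^sup>*\<^bsub>G \<restriction> (verts G - S)\<^esub> v"
    proof
      assume uv: "u \<rightarrow>\<^sup>*\<^bsub>G \<restriction> (verts G - S)\<^esub> v"
      have "v \<notin> C" using H.sccs_verts_disjoint CD by blast
      then show False
        using uv reachable_induce_sym[OF uv] CD(2,4)
        unfolding H.in_sccs_verts_conv_reachable by blast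
    qed
    ultimately show ?R using CD by blast
  next
    assume R: ?R
    then have "v \<notin> H.scc_of u" by (auto simp: H.scc_of_def)
    then show ?L using R comp[of u] comp[of v] unfolding separates_def by blast
  qed
qed

lemma separates_commute: "separates G u v S \<longleftrightarrow> separates G v u S"
  using reachable_induce_sym by (auto simp: separates_iff)

lemma uv_separator_commute: "uv_separator G u v S \<longleftrightarrow> uv_separator G v u S"
  by (simp add: uv_separator_def separates_commute)

lemma uv_separatorD:
  assumes "uv_separator G u v S"
  shows "S \<subseteq> verts G" "u \<in> verts G - S" "v \<in> verts G - S"
    "\<not> u \<rightarrow>\<^sup>*\<^bsub>G \<restriction> (verts G - S)\<^esub> v"
  using conjunct1[OF assms[unfolded uv_separator_def]] unfolding separates_iff by blast+

lemma in_separators_iff: "S \<in> separators G \<longleftrightarrow> (\<exists>u v. uv_separator G u v S)"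
  unfolding separators_def using uv_separatorD(2,3) by blast

text \<open>Without such an \<open>x\<close>, putting \<open>s\<close> back would not enlarge the
  component of \<open>u\<close>, and \<open>S - {s}\<close> would still separate, against
  minimality.\<close>

lemma uv_separator_neighbor:
  assumes "uv_separator G u v S" "s \<in> S"
  shows "\<exists>x. u \<rightarrow>\<^sup>*\<^bsub>G \<restriction> (verts G - S)\<^esub> x \<and> x \<rightarrow>\<^bsub>G\<^esub> s"
proof (rule ccontr)
  assume none: "\<nexists>x. u \<rightarrow>\<^sup>*\<^bsub>G \<restriction> (verts G - S)\<^esub> x \<and> x \<rightarrow>\<^bsub>G\<^esub> s"
  note sep = uv_separatorD[OF assms(1)]
  have "S - {s} \<subset> S" using assms(2) by blast
  then have "\<not> separates G u v (S - {s})"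
    using assms(1) by (simp add: uv_separator_def)
  then have "u \<rightarrow>\<^sup>*\<^bsub>G \<restriction> (verts G - (S - {s}))\<^esub> v"
    using sep(1-3) unfolding separates_iff by blast
  then have "u \<rightarrow>\<^sup>*\<^bsub>G \<restriction> (verts G - S)\<^esub> v"
  proof (induct rule: reachable_induce_induct)
    case base
    then show ?case using sep by (simp add: reachable_induce_refl)
  next
    case (step x y)
    then show ?case using none reachable_induce_step by blast
  qed
  then show False using sep by blast
qed

text \<open>The connections from \<open>u\<close> to \<open>u'\<close> and from \<open>v\<close> to
  \<open>v'\<close> survive when only some \<open>T \<subseteq> S\<close> is deleted. So such a
  \<open>T\<close> separates one pair if and only if it separates the other, and minimality carries
  over.\<close>

lemma uv_separator_move:
  assumes "uv_separator G u v S"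
    and "u \<rightarrow>\<^sup>*\<^bsub>G \<restriction> (verts G - S)\<^esub> u'" "v \<rightarrow>\<^sup>*\<^bsub>G \<restriction> (verts G - S)\<^esub> v'"
  shows "uv_separator G u' v' S"
proof -
  have mono: "x \<rightarrow>\<^sup>*\<^bsub>G \<restriction> (verts G - T)\<^esub> y"
    if "T \<subseteq> S" "x \<rightarrow>\<^sup>*\<^bsub>G \<restriction> (verts G - S)\<^esub> y" for T x y
    using that(2) by (rule reachable_induce_ss) (use that(1) in auto)
  have connect: "u \<rightarrow>\<^sup>*\<^bsub>G \<restriction> (verts G - T)\<^esub> v \<longleftrightarrow> u' \<rightarrow>\<^sup>*\<^bsub>G \<restriction> (verts G - T)\<^esub> v'"
    if "T \<subseteq> S" for T
    using mono[OF that assms(2)] mono[OF that assms(3)] reachable_induce_trans reachable_induce_sym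
    by blast
  have "u' \<in> verts G - S" "v' \<in> verts G - S"
    using assms(2,3) reachable_induce_in by blast+
  then show ?thesis
    using assms(1) connect unfolding uv_separator_def separates_iff by blast
qed

section \<open>Dirac's theorem: separators of chordal graphs are cliques\<close>

text \<open>Confining the interior to one component ensures that two such paths through different
  components meet only in their ends and have no arcs between their interiors.\<close>

lemma chordless_path_through:
  assumes "u \<rightarrow>\<^sup>*\<^bsub>G \<restriction> W\<^esub> x" "u \<rightarrow>\<^sup>*\<^bsub>G \<restriction> W\<^esub> y" "x \<rightarrow>\<^bsub>G\<^esub> s" "y \<rightarrow>\<^bsub>G\<^esub> t" "W \<subseteq> verts G"
  shows "\<exists>p. chordless_path s p t \<and>
    set (awalk_verts s p) \<subseteq> {s, t} \<union> {z. u \<rightarrow>\<^sup>*\<^bsub>G \<restriction> W\<^esub> z}"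
proof -
  let ?A = "{s, t} \<union> {z. u \<rightarrow>\<^sup>*\<^bsub>G \<restriction> W\<^esub> z}"
  have reach: "u \<rightarrow>\<^sup>*\<^bsub>G \<restriction> ?A\<^esub> z" if "u \<rightarrow>\<^sup>*\<^bsub>G \<restriction> W\<^esub> z" for z
    using that
  proof (induct rule: reachable_induce_induct)
    case base
    have "u \<rightarrow>\<^sup>*\<^bsub>G \<restriction> W\<^esub> u" using assms(1) reachable_induce_in reachable_induce_refl by blast
    then show ?case by (auto intro: reachable_induce_refl)
  next
    case (step a b)
    then have "u \<rightarrow>\<^sup>*\<^bsub>G \<restriction> W\<^esub> b" using reachable_induce_step by blast
    then show ?case using step reachable_induce_step[where W = ?A] by blast
  qed
  have "u \<rightarrow>\<^sup>*\<^bsub>G \<restriction> ?A\<^esub> s" "u \<rightarrow>\<^sup>*\<^bsub>G \<restriction> ?A\<^esub> t"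
    using reachable_induce_step reach assms(1-4) by blast+
  then have "s \<rightarrow>\<^sup>*\<^bsub>G \<restriction> ?A\<^esub> t" using reachable_induce_sym reachable_induce_trans by blast
  moreover have "?A \<subseteq> verts G"
    using assms(3-5) adj_in_verts reachable_induce_in(2) by blast
  ultimately show ?thesis by (rule reachable_induce_chordless_path)
qed

lemma chordless_path_length:
  assumes "chordless_path s p t" "s \<noteq> t" "\<not> s \<rightarrow>\<^bsub>G\<^esub> t"
  shows "2 \<le> length p"
proof (rule ccontr)
  assume "\<not> 2 \<le> length p"
  then have "p = [] \<or> (\<exists>e. p = [e])" by (cases p; cases "tl p") auto
  then show False
    using assms by (auto simp: chordless_path_def apath_simps in_arcs_imp_in_arcs_ends)
qed

text \<open>Two non-adjacent vertices \<open>s\<close>, \<open>t\<close> of \<open>S\<close> are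
  joined by a chordless path through the component of \<open>u\<close> and by another through that
  of \<open>v\<close>. Together these form an induced cycle.\<close>

lemma uv_separator_clique:
  assumes "chordal G" "uv_separator G u v S"
  shows "clique G S"
proof (rule ccontr)
  let ?W = "verts G - S"
  note sep = uv_separatorD(1,4)[OF assms(2)]
  assume "\<not> clique G S"
  then obtain s t where st: "s \<in> S" "t \<in> S" "s \<noteq> t" "\<not> s \<rightarrow>\<^bsub>G\<^esub> t"
    using sep by (auto simp: clique_def)
  then have ts: "\<not> t \<rightarrow>\<^bsub>G\<^esub> s" using dominates_sym by blast
  obtain x y where "u \<rightarrow>\<^sup>*\<^bsub>G \<restriction> ?W\<^esub> x" "u \<rightarrow>\<^sup>*\<^bsub>G \<restriction> ?W\<^esub> y" "x \<rightarrow>\<^bsub>G\<^esub> s" "y \<rightarrow>\<^bsub>G\<^esub> t"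
    using uv_separator_neighbor[OF assms(2) st(1)] uv_separator_neighbor[OF assms(2) st(2)] by blast
  from chordless_path_through[OF this] obtain p where p: "chordless_path s p t"
    "set (awalk_verts s p) \<subseteq> {s, t} \<union> {z. u \<rightarrow>\<^sup>*\<^bsub>G \<restriction> ?W\<^esub> z}"
    by blast
  have "uv_separator G v u S" using assms(2) uv_separator_commute by simp
  then obtain x y where "v \<rightarrow>\<^sup>*\<^bsub>G \<restriction> ?W\<^esub> x" "v \<rightarrow>\<^sup>*\<^bsub>G \<restriction> ?W\<^esub> y" "x \<rightarrow>\<^bsub>G\<^esub> t" "y \<rightarrow>\<^bsub>G\<^esub> s"
    using uv_separator_neighbor st(1,2) by blast
  from chordless_path_through[OF this] obtain q where q: "chordless_path t q s"
    "set (awalk_verts t q) \<subseteq> {s, t} \<union> {z. v \<rightarrow>\<^sup>*\<^bsub>G \<restriction> ?W\<^esub> z}"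
    by blast
  have far: "x \<noteq> y" "\<not> x \<rightarrow>\<^bsub>G\<^esub> y"
    if "u \<rightarrow>\<^sup>*\<^bsub>G \<restriction> ?W\<^esub> x" "v \<rightarrow>\<^sup>*\<^bsub>G \<restriction> ?W\<^esub> y" for x y
  proof -
    have "\<not> u \<rightarrow>\<^sup>*\<^bsub>G \<restriction> ?W\<^esub> y"
      using that(2) sep(2) reachable_induce_trans reachable_induce_sym by blast
    then show "x \<noteq> y" "\<not> x \<rightarrow>\<^bsub>G\<^esub> y"
      using that(1) reachable_induce_step reachable_induce_in(2)[OF that(2)] by blast+
  qed
  have outside: "x \<noteq> s" "x \<noteq> t" if "u \<rightarrow>\<^sup>*\<^bsub>G \<restriction> ?W\<^esub> x \<or> v \<rightarrow>\<^sup>*\<^bsub>G \<restriction> ?W\<^esub> x" for x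
    using that st reachable_induce_in(2) by blast+
  have pw: "awalk s p t" "distinct (awalk_verts s p)" and qw: "awalk t q s" "distinct (awalk_verts t q)"
    using p q by (auto simp: chordless_path_def apath_def)
  have ptl: "awalk_verts s p = s # tl (awalk_verts s p)" and qtl: "awalk_verts t q = t # tl (awalk_verts t q)"
    using pw qw by (metis awhd_of_awalk awalk_verts_non_Nil list.collapse)+
  \<comment> \<open>Since \<open>s\<close> and \<open>t\<close> are distinct and non-adjacent, each
    path has at least two arcs, so the cycle has at least four.\<close>
  have len: "2 \<le> length p" "2 \<le> length q"
    using chordless_path_length p(1) q(1) st ts by blast+
  have closed: "awalk s (p @ q) s" using pw qw by auto
  have "awalk_verts s (p @ q) = awalk_verts s p @ tl (awalk_verts t q)"
    using closed pw by (simp add: awalk_verts_append)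
  \<comment> \<open>\<open>cycle\<close> asks for distinctness of the vertex list without its head,
    because the start \<open>s\<close> returns at the end.\<close>
  then have tl: "tl (awalk_verts s (p @ q)) = tl (awalk_verts s p) @ tl (awalk_verts t q)"
    by (simp add: awalk_verts_conv)
  have "s \<notin> set (tl (awalk_verts s p))" "t \<notin> set (tl (awalk_verts t q))"
    using pw(2) qw(2) ptl qtl by (metis distinct.simps(2))+
  moreover have "set (tl (awalk_verts s p)) \<subseteq> set (awalk_verts s p)"
    "set (tl (awalk_verts t q)) \<subseteq> set (awalk_verts t q)"
    by (metis awalk_verts_non_Nil list.set_sel(2) subsetI)+
  \<comment> \<open>Only \<open>s\<close> and \<open>t\<close> lie on both paths, and each tail
    omits the start of its own path.\<close>
  ultimately have "set (tl (awalk_verts s p)) \<inter> set (tl (awalk_verts t q)) = {}"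
    using p(2) q(2) far outside by blast
  then have "distinct (tl (awalk_verts s (p @ q)))"
    using pw(2) qw(2) by (simp add: tl distinct_tl)
  then have "cycle (p @ q)"
    unfolding cycle_def using closed len(1) by (intro exI[of _ s]) auto
  moreover have "\<exists>e \<in> set (p @ q).
      arc_to_ends G a = (tail G e, head G e) \<or> arc_to_ends G a = (head G e, tail G e)"
    if a: "a \<in> arcs (G \<restriction> (tail G ` set (p @ q)))" for a
  proof -
    obtain x y where xy: "arc_to_ends G a = (x, y)" by fastforce
    then have dom: "x \<rightarrow>\<^bsub>G\<^esub> y" using a by (auto intro: dominatesI)
    have "tail G e \<in> set (awalk_verts s p) \<union> set (awalk_verts t q)" if "e \<in> set (p @ q)" for e
      using that awalk_verts_arc1 by auto
    then have "x \<in> set (awalk_verts s p) \<union> set (awalk_verts t q)"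
      "y \<in> set (awalk_verts s p) \<union> set (awalk_verts t q)"
      using a xy unfolding arc_to_ends_def by fastforce+
    moreover have "s \<in> set (awalk_verts s p)" "t \<in> set (awalk_verts t q)"
      using pw(1) qw(1) by (simp_all add: hd_in_awalk_verts)
    moreover have "awlast s p = t" "awlast t q = s" using pw(1) qw(1) by (auto elim: awalkE)
    then have "t \<in> set (awalk_verts s p)" "s \<in> set (awalk_verts t q)"
      by (metis awalk_verts_non_Nil last_in_set)+
    \<comment> \<open>No arc joins the two components, and \<open>s\<close> and \<open>t\<close>
      belong to both paths; so both ends of the arc lie on a common path.\<close>
    ultimately consider "x \<in> set (awalk_verts s p)" "y \<in> set (awalk_verts s p)"
      | "x \<in> set (awalk_verts t q)" "y \<in> set (awalk_verts t q)"
      using p(2) q(2) far dom dominates_sym by blast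
    then show ?thesis
    proof cases
      case 1
      then obtain e where "e \<in> set p" "(x, y) = (tail G e, head G e) \<or> (x, y) = (head G e, tail G e)"
        using p(1) dom unfolding chordless_path_def by meson
      then show ?thesis using xy by auto
    next
      case 2
      then obtain e where "e \<in> set q" "(x, y) = (tail G e, head G e) \<or> (x, y) = (head G e, tail G e)"
        using q(1) dom unfolding chordless_path_def by meson
      then show ?thesis using xy by auto
    qed
  qed
  ultimately have "induced_cycle G (p @ q)" by (simp add: induced_cycle_def)
  then show False using assms(1) len by (force simp: chordal_def)
qed

end

section \<open>One side of a clique separator\<close>

text \<open>The main proof uses this once for each order of the two ends, so it suffices to treat
  the side of \<open>a\<close>. Chordality enters here only through separators being
  cliques.\<close>

locale clique_separated = graph G for G :: "('a, 'b) pre_digraph" (structure) +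
  fixes a b :: 'a and S :: "'a set"
  assumes sep: "uv_separator G a b S"
    and clique_S: "clique G S"
begin

definition C :: "'a set" where
  "C = {x. a \<rightarrow>\<^sup>*\<^bsub>G \<restriction> (verts G - S)\<^esub> x}"

definition H :: "('a, 'b) pre_digraph" where
  "H = G \<restriction> (C \<union> S)"

lemma S_subset: "S \<subseteq> verts G"
  using sep by (rule uv_separatorD)

lemma C_subset: "C \<subseteq> verts G - S"
  unfolding C_def using reachable_induce_in(2) by blast

lemma a_in_C: "a \<in> C"
  using uv_separatorD(2)[OF sep] reachable_induce_refl unfolding C_def by blast

lemma b_notin: "b \<notin> C \<union> S" "b \<in> verts G"
  using uv_separatorD[OF sep] unfolding C_def by blast+

lemma graph_H: "graph H"
  unfolding H_def using graph_induce_subgraph[OF graph_axioms] C_subset S_subset by blast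

lemma verts_H [simp]: "verts H = C \<union> S"
  by (simp add: H_def)

lemma dominates_H: "x \<rightarrow>\<^bsub>H\<^esub> y \<longleftrightarrow> x \<in> C \<union> S \<and> y \<in> C \<union> S \<and> x \<rightarrow>\<^bsub>G\<^esub> y"
  by (simp only: H_def dominates_induce_subgraph_iff)

lemma C_closed:
  assumes "x \<in> C" "x \<rightarrow>\<^bsub>G\<^esub> y"
  shows "y \<in> C \<union> S"
  using assms reachable_induce_step adj_in_verts(2) unfolding C_def by blast

lemma S_neighbor_C:
  assumes "s \<in> S"
  shows "\<exists>x \<in> C. x \<rightarrow>\<^bsub>G\<^esub> s"
  using uv_separator_neighbor[OF sep assms] unfolding C_def by blast

lemma S_neighbor_outside:
  assumes "s \<in> S"
  shows "\<exists>x \<in> verts G - (C \<union> S). x \<rightarrow>\<^bsub>G\<^esub> s"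
proof -
  have "uv_separator G b a S" using sep uv_separator_commute by simp
  from uv_separator_neighbor[OF this assms]
  obtain x where x: "b \<rightarrow>\<^sup>*\<^bsub>G \<restriction> (verts G - S)\<^esub> x" "x \<rightarrow>\<^bsub>G\<^esub> s" by blast
  have "x \<notin> C"
  proof
    assume "x \<in> C"
    then have "b \<in> C"
      unfolding C_def using x(1) reachable_induce_sym reachable_induce_trans by blast
    then show False using b_notin by blast
  qed
  then show ?thesis using x reachable_induce_in(2)[OF x(1)] by blast
qed

text \<open>A walk leaving \<open>C \<union> S\<close> does so through the clique \<open>S\<close> and can be shortcut there.\<close>

lemma reachable_shortcut:
  assumes "p \<in> C \<union> S - T" "q \<in> C \<union> S - T"
  shows "p \<rightarrow>\<^sup>*\<^bsub>G \<restriction> (verts G - T)\<^esub> q \<longleftrightarrow> p \<rightarrow>\<^sup>*\<^bsub>G \<restriction> (C \<union> S - T)\<^esub> q"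
proof
  let ?R = "\<lambda>z. p \<rightarrow>\<^sup>*\<^bsub>G \<restriction> (C \<union> S - T)\<^esub> z"
  assume "p \<rightarrow>\<^sup>*\<^bsub>G \<restriction> (verts G - T)\<^esub> q"
  \<comment> \<open>While the walk is outside \<open>C \<union> S\<close>, the invariant remembers a
    vertex of \<open>S\<close> already reached inside; the walk can only return through
    \<open>S\<close>, which is one clique arc away from it.\<close>
  then have "if q \<in> C \<union> S then ?R q else \<exists>s \<in> S. ?R s"
  proof (induct rule: reachable_induce_induct)
    case base
    then show ?case using assms reachable_induce_refl by auto
  next
    case (step x y)
    have step_R: "?R z" if "?R w" "w \<rightarrow>\<^bsub>G\<^esub> z" "z \<in> C \<union> S - T" for w z
      using that by (rule reachable_induce_step)
    have y_sym: "y \<rightarrow>\<^bsub>G\<^esub> x" using step(2) by (rule dominates_sym)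
    consider "x \<in> C \<union> S" "y \<in> C \<union> S" | "x \<in> C \<union> S" "y \<notin> C \<union> S"
      | "x \<notin> C \<union> S" "y \<in> C \<union> S" | "x \<notin> C \<union> S" "y \<notin> C \<union> S" by blast
    then show ?case
    proof cases
      case 1
      then show ?thesis using step step_R by auto
    next
      case 2
      then have "x \<in> S" using C_closed step(2) by blast
      then show ?thesis using 2 step by auto
    next
      case 3
      then have "y \<in> S" using C_closed y_sym by blast
      obtain s where s: "s \<in> S" "?R s" using 3 step by auto
      then have "?R y"
        using \<open>y \<in> S\<close> step(4) step_R[OF s(2)] clique_S unfolding clique_def by (cases "s = y") auto
      then show ?thesis using 3 by simp
    next
      case 4
      then show ?thesis using step by auto
    qed
  qed
  then show "?R q" using assms by simp
next
  assume "p \<rightarrow>\<^sup>*\<^bsub>G \<restriction> (C \<union> S - T)\<^esub> q"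
  then show "p \<rightarrow>\<^sup>*\<^bsub>G \<restriction> (verts G - T)\<^esub> q"
    by (rule reachable_induce_ss) (use C_subset S_subset in blast)
qed

section \<open>Separators of the subgraph \<open>H\<close>\<close>

lemma separates_H_iff:
  assumes "p \<in> C \<union> S" "q \<in> C \<union> S" "T \<subseteq> C \<union> S"
  shows "separates H p q T \<longleftrightarrow> separates G p q T"
proof -
  have "H \<restriction> (C \<union> S - T) = G \<restriction> (C \<union> S - T)"
    unfolding H_def by (rule induce_subgraph_induce_subgraph) blast
  then show ?thesis
    unfolding graph.separates_iff[OF graph_H] separates_iff verts_H
    using assms C_subset S_subset reachable_shortcut[of p T q] by auto
qed

lemma uv_separator_H_iff:
  assumes "p \<in> C \<union> S" "q \<in> C \<union> S" "T \<subseteq> C \<union> S"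
  shows "uv_separator H p q T \<longleftrightarrow> uv_separator G p q T"
proof -
  have "separates H p q T' \<longleftrightarrow> separates G p q T'" if "T' \<subseteq> T" for T'
    using assms that by (intro separates_H_iff) auto
  then show ?thesis unfolding uv_separator_def by blast
qed

lemma separators_H_subset: "separators H \<subseteq> separators G"
proof
  fix T
  assume "T \<in> separators H"
  then obtain p q where pq: "uv_separator H p q T" "p \<in> C \<union> S" "q \<in> C \<union> S"
    by (auto simp: separators_def)
  then have "T \<subseteq> C \<union> S" using graph.uv_separatorD(1)[OF graph_H pq(1)] by simp
  then have "uv_separator G p q T" using pq uv_separator_H_iff by blast
  then show "T \<in> separators G" using in_separators_iff by blast
qed

text \<open>Deleting only vertices of \<open>S\<close> from \<open>H\<close> leaves \<open>C\<close>
  intact and connected, and every remaining vertex of \<open>S\<close> has a neighbor in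
  \<open>C\<close>. So nothing gets separated.\<close>

lemma separator_H_not_subset:
  assumes "T \<in> separators H"
  shows "\<not> T \<subseteq> S"
proof
  assume T: "T \<subseteq> S"
  let ?R = "\<lambda>z. a \<rightarrow>\<^sup>*\<^bsub>G \<restriction> (C \<union> S - T)\<^esub> z"
  have RC: "?R z" if "z \<in> C" for z
    using that unfolding C_def mem_Collect_eq
  proof (induct rule: reachable_induce_induct)
    case base
    have "a \<in> C \<union> S - T" using a_in_C C_subset T by blast
    then show ?case unfolding C_def by (rule reachable_induce_refl)
  next
    case (step x y)
    then have "x \<in> C" unfolding C_def by blast
    then have "y \<in> C" using C_closed step by blast
    then have "y \<in> C \<union> S - T" using step T by blast
    with step(5,2) show ?case unfolding C_def by (rule reachable_induce_step)
  qed
  have R: "?R z" if "z \<in> C \<union> S - T" for z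
  proof (cases "z \<in> C")
    case False
    then obtain x where "x \<in> C" "x \<rightarrow>\<^bsub>G\<^esub> z" using \<open>z \<in> C \<union> S - T\<close> S_neighbor_C by blast
    then show ?thesis using RC that reachable_induce_step by blast
  qed (rule RC)
  obtain p q where pq: "separates H p q T"
    using assms unfolding separators_def uv_separator_def by blast
  then have "p \<in> C \<union> S - T" "q \<in> C \<union> S - T"
    unfolding graph.separates_iff[OF graph_H] by simp_all
  moreover have "separates G p q T" using calculation pq T separates_H_iff[of p q T] by blast
  ultimately show False
    using R reachable_shortcut[of p T q] reachable_induce_sym reachable_induce_trans
    unfolding separates_iff by blast
qed

section \<open>Transfer of special vertices from \<open>H\<close> to \<open>G\<close>\<close>

lemma neighbors_H:
  assumes "x \<in> C"
  shows "neighbors H x = neighbors G x"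
  using assms C_closed by (auto simp: neighbors_def dominates_H)

text \<open>Vertices of \<open>C\<close> have no neighbors beyond \<open>C \<union> S\<close>, so
  passing to \<open>G\<close> can only add vertices of \<open>S\<close> to the boundary; by
  assumption those in question are there already.\<close>

lemma boundary_H:
  assumes "x \<in> C" "S \<inter> closed_neighbors G x \<subseteq> boundary H x"
  shows "boundary G x = boundary H x"
proof
  have Q: "closed_neighbors H x = closed_neighbors G x"
    using neighbors_H[OF assms(1)] by (simp add: closed_neighbors_def)
  show "boundary H x \<subseteq> boundary G x"
    using C_subset S_subset unfolding boundary_def Q by (auto simp: neighbors_def dominates_H)
  show "boundary G x \<subseteq> boundary H x"
  proof
    fix y
    assume "y \<in> boundary G x"
    then obtain w where y: "y \<in> closed_neighbors G x" "w \<in> verts G - closed_neighbors G x"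
      "w \<rightarrow>\<^bsub>G\<^esub> y"
      by (auto simp: boundary_def neighbors_def)
    have y_H: "y \<in> C \<union> S"
      using y(1) assms(1) C_closed by (auto simp: closed_neighbors_def neighbors_def)
    show "y \<in> boundary H x"
    proof (cases "y \<in> S")
      case True
      then show ?thesis using assms(2) y(1) by blast
    next
      case False
      then have "w \<in> C \<union> S" using y_H C_closed dominates_sym[OF y(3)] by blast
      then show ?thesis
        using y y_H unfolding boundary_def Q by (auto simp: neighbors_def dominates_H)
    qed
  qed
qed

lemma special_if_special_H:
  assumes cliques: "\<And>T. T \<in> separators G \<Longrightarrow> clique G T"
    and x: "x \<in> C" "special H x" "S \<inter> closed_neighbors G x \<subseteq> boundary H x"
  shows "special G x"
  unfolding special_def
proof (intro conjI ballI)
  note bd = boundary_H[OF x(1,3)]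
  have bd_sep: "boundary H x \<in> separators H"
    and maximal: "\<And>T. T \<in> separators H \<Longrightarrow> \<not> boundary H x \<subset> T"
    using x(2) by (auto simp: special_def)
  show "simplicial G x"
  proof -
    have "x \<in> C \<union> S" "clique H (neighbors G x)"
      using x(2) neighbors_H[OF x(1)] by (auto simp: special_def simplicial_def)
    then show ?thesis
      using C_subset S_subset unfolding simplicial_def clique_def dominates_H verts_H by blast
  qed
  show "boundary G x \<in> separators G"
    using bd bd_sep separators_H_subset by auto
  fix T
  assume T: "T \<in> separators G"
  show "\<not> boundary G x \<subset> T"
  proof
    assume less: "boundary G x \<subset> T"
    have "boundary H x \<subseteq> C \<union> S"
      using x(1) C_closed neighbors_H[OF x(1)]
      by (auto simp: boundary_def closed_neighbors_def neighbors_def)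
    \<comment> \<open>The boundary is a separator of \<open>H\<close>, hence not inside
      \<open>S\<close>, so it contains a vertex of \<open>C\<close>, and so does
      \<open>T\<close>.\<close>
    then obtain c where c: "c \<in> T" "c \<in> C"
      using less bd separator_H_not_subset[OF bd_sep] by blast
    have T_sub: "T \<subseteq> C \<union> S"
    proof
      fix t
      assume "t \<in> T"
      then have "t = c \<or> c \<rightarrow>\<^bsub>G\<^esub> t" using cliques[OF T] c(1) by (auto simp: clique_def)
      then show "t \<in> C \<union> S" using c(2) C_closed by blast
    qed
    obtain p q where pq: "uv_separator G p q T" using T in_separators_iff by blast
    then have qp: "uv_separator G q p T" using uv_separator_commute by simp
    \<comment> \<open>The ends \<open>p\<close> and \<open>q\<close> may lie outside
      \<open>H\<close>. By minimality of \<open>T\<close> each can be replaced by a neighbor of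
      \<open>c\<close> in its own component, and neighbors of \<open>c\<close> lie in
      \<open>C \<union> S\<close>.\<close>
    obtain p' q' where p': "p \<rightarrow>\<^sup>*\<^bsub>G \<restriction> (verts G - T)\<^esub> p'" "p' \<rightarrow>\<^bsub>G\<^esub> c"
      and q': "q \<rightarrow>\<^sup>*\<^bsub>G \<restriction> (verts G - T)\<^esub> q'" "q' \<rightarrow>\<^bsub>G\<^esub> c"
      using uv_separator_neighbor[OF pq c(1)] uv_separator_neighbor[OF qp c(1)] by blast
    have "p' \<in> C \<union> S" "q' \<in> C \<union> S"
      using C_closed c(2) dominates_sym p'(2) q'(2) by blast+
    then have "uv_separator H p' q' T"
      using uv_separator_move[OF pq p'(1) q'(1)] T_sub uv_separator_H_iff by blast
    then have "T \<in> separators H" using graph.in_separators_iff[OF graph_H] by blast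
    then show False using maximal less bd by blast
  qed
qed

text \<open>Here the closed neighborhood of \<open>a\<close> is all of \<open>C \<union> S\<close>.
  Of its vertices, those of \<open>C\<close> have no neighbor outside, while those of
  \<open>S\<close> have one, so the boundary is the maximal separator \<open>S\<close>.\<close>

lemma special_if_clique_H:
  assumes "clique H (verts H)" "\<And>T. T \<in> separators G \<Longrightarrow> \<not> S \<subset> T"
  shows "special G a"
proof -
  have N: "neighbors G a = C \<union> S - {a}"
  proof
    show "neighbors G a \<subseteq> C \<union> S - {a}"
      using C_closed[OF a_in_C] dominates_irrefl unfolding neighbors_def by blast
    show "C \<union> S - {a} \<subseteq> neighbors G a"
    proof
      fix y
      assume "y \<in> C \<union> S - {a}"
      then have "a \<rightarrow>\<^bsub>H\<^esub> y" using a_in_C by (intro cliqueD[OF assms(1)]) auto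
      then show "y \<in> neighbors G a" by (simp add: neighbors_def dominates_H)
    qed
  qed
  then have Q: "closed_neighbors G a = C \<union> S"
    using a_in_C by (auto simp: closed_neighbors_def)
  have "boundary G a = S"
  proof
    show "boundary G a \<subseteq> S"
      unfolding boundary_def Q neighbors_def using C_closed dominates_sym by blast
    show "S \<subseteq> boundary G a"
      unfolding boundary_def Q neighbors_def using S_neighbor_outside by blast
  qed
  moreover have "S \<in> separators G" using sep in_separators_iff by blast
  moreover have "simplicial G a"
    unfolding simplicial_def
  proof
    show "a \<in> verts G" using a_in_C C_subset by blast
    have "clique G (C \<union> S)"
      using cliqueD[OF assms(1)] C_subset S_subset by (auto simp: clique_def dominates_H)
    then show "clique G (neighbors G a)" unfolding N clique_def by blast
  qed
  ultimately show ?thesis using assms(2) by (simp add: special_def)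
qed

text \<open>
  The boundary in \<open>G\<close> can only be larger than in \<open>H\<close> if \<open>x\<close> is adjacent to all of \<open>S\<close>. If this holds for
  both of the given vertices, then every vertex of \<open>S\<close> has the other one as a neighbor outside \<open>Q\<^sub>x\<close>.
\<close>

lemma special_H_choice:
  assumes uv: "u \<noteq> v" "\<not> u \<rightarrow>\<^bsub>H\<^esub> v" and u: "special H u" and v: "special H v"
  shows "\<exists>x \<in> C. special H x \<and> S \<inter> closed_neighbors G x \<subseteq> boundary H x"
proof -
  have in_H: "u \<in> C \<union> S" "v \<in> C \<union> S"
    using u v by (auto simp: special_def simplicial_def)
  then have uvG: "\<not> u \<rightarrow>\<^bsub>G\<^esub> v" "\<not> v \<rightarrow>\<^bsub>G\<^esub> u"
    using uv dominates_sym unfolding dominates_H by blast+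
  \<comment> \<open>A single vertex \<open>t\<close> of \<open>H\<close> outside the closed
    neighborhood of \<open>x\<close> witnesses the boundary for all vertices of \<open>S\<close> at
    once.\<close>
  have good: "S \<inter> closed_neighbors G x \<subseteq> boundary H x"
    if x: "x \<in> C" "t \<in> C \<union> S" "t \<notin> closed_neighbors G x"
      "\<And>s. s \<in> S \<Longrightarrow> s \<in> closed_neighbors G x \<Longrightarrow> t \<rightarrow>\<^bsub>G\<^esub> s" for x t
  proof -
    have "closed_neighbors H x = closed_neighbors G x"
      using neighbors_H[OF x(1)] by (simp add: closed_neighbors_def)
    then show ?thesis
      using x unfolding boundary_def by (auto simp: neighbors_def dominates_H)
  qed
  \<comment> \<open>A vertex \<open>t\<close> of \<open>S\<close> not adjacent to \<open>x\<close>
    is such a witness, because \<open>S\<close> is a clique.\<close>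
  have good_S: "S \<inter> closed_neighbors G x \<subseteq> boundary H x"
    if x: "x \<in> C" "t \<in> S" "t \<notin> closed_neighbors G x" for x t
    using x clique_S by (intro good[of x t]) (auto simp: clique_def)
  have far: "u \<notin> closed_neighbors G v" "v \<notin> closed_neighbors G u"
    using uv(1) uvG by (auto simp: closed_neighbors_def neighbors_def)
  consider "u \<in> C" "v \<in> S" | "u \<in> S" "v \<in> C" | "u \<in> C" "v \<in> C"
    using in_H uv(1) uvG clique_S unfolding clique_def by blast
  then show ?thesis
  proof cases
    case 1
    then show ?thesis using good_S far u by blast
  next
    case 2
    then show ?thesis using good_S far v by blast
  next
    case 3
    show ?thesis
    \<comment> \<open>If \<open>v\<close> is adjacent to all of \<open>S\<close>, it serves as the
      witness for \<open>u\<close>; otherwise \<open>v\<close> misses a vertex of \<open>S\<close>,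
      which serves as the witness for \<open>v\<close>.\<close>
    proof (cases "S \<subseteq> closed_neighbors G v")
      case True
      then have "v \<rightarrow>\<^bsub>G\<^esub> s" if "s \<in> S" for s
        using that 3 C_subset by (auto simp: closed_neighbors_def neighbors_def)
      then show ?thesis using good[of u v] 3 far u by blast
    next
      case False
      then show ?thesis using good_S 3 v by blast
    qed
  qed
qed

end

section \<open>Existence of separators and the induction\<close>

text \<open>Two non-adjacent vertices are separated by the set of all other vertices; a minimal
  separating set exists by finiteness.\<close>

lemma (in graph) separators_nonempty:
  assumes "\<not> clique G (verts G)"
  shows "separators G \<noteq> {}"
proof -
  obtain u v where uv: "u \<in> verts G" "v \<in> verts G" "u \<noteq> v" "\<not> u \<rightarrow>\<^bsub>G\<^esub> v"
    using assms by (auto simp: clique_def)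
  let ?F = "{S. separates G u v S}"
  have "separates G u v (verts G - {u, v})"
    unfolding separates_iff
  proof (intro conjI notI)
    have "verts G - (verts G - {u, v}) = {u, v}" using uv by blast
    moreover assume "u \<rightarrow>\<^sup>*\<^bsub>G \<restriction> (verts G - (verts G - {u, v}))\<^esub> v"
    ultimately have "u \<rightarrow>\<^sup>*\<^bsub>G \<restriction> {u, v}\<^esub> v" by simp
    then have "v = u"
      by (induct rule: reachable_induce_induct) (use uv in auto)
    then show False using uv by simp
  qed (use uv in auto)
  moreover have "finite ?F"
    by (rule finite_subset[of _ "Pow (verts G)"]) (auto simp: separates_iff)
  ultimately obtain S where "S \<in> ?F" "\<forall>T \<in> ?F. T \<subseteq> S \<longrightarrow> S = T"
    using finite_has_minimal[of ?F] by blast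
  then have "uv_separator G u v S" unfolding uv_separator_def by blast
  then show ?thesis using in_separators_iff by blast
qed

lemma (in graph) finite_separators: "finite (separators G)"
proof (rule finite_subset)
  show "separators G \<subseteq> Pow (verts G)"
    using in_separators_iff uv_separatorD(1) by (meson PowI subsetI)
qed simp

theorem theorem2:
  fixes G :: "('a, 'b) pre_digraph"
  assumes "graph G"
    and "chordal G"
    and "\<not> clique G (verts G)"
  shows "\<exists>u \<in> verts G. \<exists>v \<in> verts G. u \<noteq> v \<and> \<not> u \<rightarrow>\<^bsub>G\<^esub> v \<and> special G u \<and> special G v"
  using assms
proof (induct "card (verts G)" arbitrary: G rule: less_induct)
  case less
  interpret graph G by fact
  have cliques: "clique G T" if "T \<in> separators G" for T
    using that in_separators_iff uv_separator_clique[OF less.prems(2)] by blast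
  obtain S where S: "S \<in> separators G" and maximal: "\<And>T. T \<in> separators G \<Longrightarrow> \<not> S \<subset> T"
    using finite_has_maximal[OF finite_separators separators_nonempty[OF less.prems(3)]] by blast
  have side: "\<exists>x. a \<rightarrow>\<^sup>*\<^bsub>G \<restriction> (verts G - S)\<^esub> x \<and> special G x" if "uv_separator G a b S" for a b
  proof -
    interpret clique_separated G a b S
      by unfold_locales (use that cliques S in auto)
    have "\<exists>x \<in> C. special G x"
    proof (cases "clique H (verts H)")
      case True
      then show ?thesis using special_if_clique_H maximal a_in_C by blast
    next
      case False
      \<comment> \<open>The vertex \<open>b\<close> is missing from \<open>H\<close>, so the
        induction hypothesis applies.\<close>
      have "C \<union> S \<subset> verts G" using C_subset S_subset b_notin by blast
      then have "card (verts H) < card (verts G)" by (simp add: psubset_card_mono)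
      moreover have "chordal H"
        unfolding H_def using chordal_induce_subgraph[OF less.prems(2)] C_subset S_subset by blast
      ultimately obtain u v where "u \<noteq> v" "\<not> u \<rightarrow>\<^bsub>H\<^esub> v" "special H u" "special H v"
        using less.hyps graph_H False by blast
      then obtain x where "x \<in> C" "special H x" "S \<inter> closed_neighbors G x \<subseteq> boundary H x"
        using special_H_choice by blast
      then show ?thesis using special_if_special_H cliques by blast
    qed
    then show ?thesis unfolding C_def by blast
  qed
  obtain a b where ab: "uv_separator G a b S" using S in_separators_iff by blast
  then have ba: "uv_separator G b a S" using uv_separator_commute by simp
  obtain u v where u: "a \<rightarrow>\<^sup>*\<^bsub>G \<restriction> (verts G - S)\<^esub> u" "special G u"
    and v: "b \<rightarrow>\<^sup>*\<^bsub>G \<restriction> (verts G - S)\<^esub> v" "special G v"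
    using side[OF ab] side[OF ba] by blast
  have "\<not> u \<rightarrow>\<^sup>*\<^bsub>G \<restriction> (verts G - S)\<^esub> v"
    using uv_separator_move[OF ab u(1) v(1)] by (rule uv_separatorD(4))
  moreover have "u \<in> verts G - S" "v \<in> verts G - S"
    using u(1) v(1) reachable_induce_in(2) by blast+
  \<comment> \<open>Equality or an arc would put \<open>u\<close> and \<open>v\<close> into the same
    component of \<open>G - S\<close>.\<close>
  ultimately have "u \<noteq> v" "\<not> u \<rightarrow>\<^bsub>G\<^esub> v"
    using reachable_induce_refl reachable_induce_step by blast+
  then show ?case using u v by (auto simp: special_def simplicial_def)
qed

end
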